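(* For all $x,y\in\mathbb{B}^2$, $$j^*_{\mathbb{B}^2}(x,y)\leq w_{\mathbb{B}^2}(x,y)\leq\sqrt{2}\,j^*_{\mathbb{B}^2}(x,y),$$ where the equality $j^*_{\mathbb{B}^2}(x,y)=w_{\mathbb{B}^2}(x,y)$ holds whenever $x,y$ are on the same ray starting from the origin, and the constant $\sqrt{2}$ is the best possible one (i.e. it cannot be replaced by a smaller constant in the second inequality).
   Context: $\mathbb{B}^2=\{x\in\mathbb{R}^2 : |x|<1\}$ is the open unit disk. For $G=\mathbb{B}^2$ and $x\in G$, let $d_G(x)=\inf\{|x-z| : z\in\partial G\}=1-|x|$ and $$\widetilde{X}=\{\widetilde{x}\in\mathbb{R}^2 : |x-\widetilde{x}|=2d_G(x),\ (x+\widetilde{x})/2\in\partial G\};$$ for $y\in G$ the set $\widetilde{Y}$ is defined in the same way from $y$. The function $w_G:G\times G\to[0,1]$ is $$w_G(x,y)=\frac{|x-y|}{\min\{\inf_{\widetilde{y}\in\widetilde{Y}}|x-\widetilde{y}|,\ \inf_{\widetilde{x}\in\widetilde{X}}|y-\widetilde{x}|\}}.$$ The $j^*_G$-metric is $$j^*_G(x,y)=\frac{|x-y|}{|x-y|+2\min\{d_G(x),d_G(y)\}}.$$ *)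

theory Defs
  imports "HOL-Analysis.Analysis"
begin

abbreviation unit_disk :: "(real^2) set" where
  "unit_disk \<equiv> ball 0 1"

definition bdist :: "(real^2) set \<Rightarrow> real^2 \<Rightarrow> real" where
  "bdist G x = infdist x (frontier G)"

definition bd_reflections :: "(real^2) set \<Rightarrow> real^2 \<Rightarrow> (real^2) set" where
  "bd_reflections G x = {x'. dist x x' = 2 * bdist G x \<and> midpoint x x' \<in> frontier G}"

(* infdist is the infimum of the distances for nonempty sets (and 0 for the empty set);
   for the unit disk the boundary and all the sets bd_reflections are nonempty, so
   the conventions for the empty set play no role. *)
definition w_fun :: "(real^2) set \<Rightarrow> real^2 \<Rightarrow> real^2 \<Rightarrow> real" where
  "w_fun G x y =
     dist x y / min (infdist x (bd_reflections G y)) (infdist y (bd_reflections G x))"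

definition jstar :: "(real^2) set \<Rightarrow> real^2 \<Rightarrow> real^2 \<Rightarrow> real" where
  "jstar G x y = dist x y / (dist x y + 2 * min (bdist G x) (bdist G y))"

definition origin_ray :: "real^2 \<Rightarrow> (real^2) set" where
  "origin_ray u = {t *\<^sub>R u | t. t \<ge> 0}"

end

theory Submission
  imports Defs
begin

text \<open>
  The reflections of a point \<open>x = r u\<close> with \<open>|u| = 1\<close> are the points \<open>(2 - r) u\<close>, the origin
  being reflected in every direction \<open>u\<close>. Let \<open>d = |x - y|\<close> and \<open>|y| \<le> |x| = r\<close>. Then the
  denominator of \<open>w\<close> is the distance from \<open>y\<close> to a reflection \<open>a\<close> of the outer point \<open>x\<close>,
  and \<open>j*\<close> has the denominator \<open>d + 2 (1 - r) = |y - x| + |x - a|\<close>. The triangle inequality gives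
  the lower bound, with equality on rays. The angle at \<open>x\<close> in the triangle with vertices \<open>y\<close>, \<open>x\<close>,
  \<open>a\<close> is not acute, so
  \<open>|y - a|\<^sup>2 \<ge> |y - x|\<^sup>2 + |x - a|\<^sup>2 \<ge> (|y - x| + |x - a|)\<^sup>2 / 2\<close>, which is the upper bound.
  For \<open>|x| = |y| = 1 - t\<close> and \<open>|x - y| = 2 t\<close> the second of these inequalities is an
  equality and the first one is an equality up to the factor \<open>1 / (1 - t)\<close>; letting \<open>t\<close> tend
  to 0 shows that the constant is optimal.
\<close>

section \<open>Boundary distance and reflections in the unit disk\<close>

lemma ex_unit_direction:
  fixes x :: "'a::euclidean_space"
  shows "\<exists>u. norm u = 1 \<and> x = norm x *\<^sub>R u"
proof (cases "x = 0")
  case True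
  then show ?thesis
    using norm_Basis SOME_Basis by fastforce
next
  case False
  then show ?thesis
    by (intro exI[of _ "x /\<^sub>R norm x"]) simp
qed

lemma infdist_greatest:
  assumes "A \<noteq> {}" "\<And>a. a \<in> A \<Longrightarrow> m \<le> dist x a"
  shows "m \<le> infdist x A"
  using assms by (simp add: infdist_notempty cINF_greatest)

text \<open>The radial boundary point \<open>u\<close> attains the distance, and the reverse
  triangle inequality shows that no boundary point is closer.\<close>

lemma bdist_unit_disk:
  assumes "norm x \<le> 1"
  shows "bdist unit_disk x = 1 - norm x"
proof -
  obtain u where u: "norm u = 1" "x = norm x *\<^sub>R u"
    using ex_unit_direction by blast
  have "u \<in> sphere 0 1"
    using u by simp
  moreover have "dist x u = 1 - norm x"
  proof -
    have "x - u = (norm x - 1) *\<^sub>R u"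
      using u(2) by (metis scaleR_left_diff_distrib scaleR_one)
    then show ?thesis
      using u(1) assms by (simp add: dist_norm)
  qed
  ultimately have "infdist x (sphere 0 1) \<le> 1 - norm x"
    by (metis infdist_le)
  moreover have "1 - norm x \<le> infdist x (sphere 0 1)"
  proof (rule infdist_greatest)
    show "sphere (0::real^2) 1 \<noteq> {}"
      using \<open>u \<in> sphere 0 1\<close> by blast
    fix z :: "real^2" assume "z \<in> sphere 0 1"
    then show "1 - norm x \<le> dist x z"
      using norm_triangle_ineq2[of z x] by (simp add: dist_norm norm_minus_commute)
  qed
  ultimately show ?thesis
    by (simp add: bdist_def)
qed

text \<open>The midpoint of \<open>x\<close> and \<open>a\<close> is a boundary point at the minimal
  distance from \<open>x\<close>, which forces it to be radial. Quantifying over \<open>u\<close>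
  also covers the origin, where every direction is admissible.\<close>

lemma bd_reflections_unit_disk:
  assumes "norm x < 1"
  shows "a \<in> bd_reflections unit_disk x \<longleftrightarrow>
    (\<exists>u. norm u = 1 \<and> x = norm x *\<^sub>R u \<and> a = (2 - norm x) *\<^sub>R u)"
proof
  assume "a \<in> bd_reflections unit_disk x"
  then have d: "dist x a = 2 * (1 - norm x)" and m: "norm (midpoint x a) = 1"
    using assms by (auto simp: bd_reflections_def bdist_unit_disk)
  define u where "u = midpoint x a"
  have u: "norm u = 1"
    using m by (simp add: u_def)
  have a: "a = 2 *\<^sub>R u - x"
    by (simp add: u_def midpoint_def)
  have nux: "norm (u - x) = 1 - norm x"
  proof -
    have "x - a = 2 *\<^sub>R (x - u)"
      by (simp add: a scaleR_2)
    then show ?thesis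
      using d by (simp add: dist_norm norm_minus_commute)
  qed
  \<comment> \<open>Equality in the triangle inequality for \<open>u = x + (u - x)\<close> makes \<open>x\<close> a multiple of \<open>u\<close>.\<close>
  have "norm (x + (u - x)) = norm x + norm (u - x)"
    using nux u by simp
  then have "norm x *\<^sub>R (u - x) = norm (u - x) *\<^sub>R x"
    by (simp only: norm_triangle_eq)
  then have "x = norm x *\<^sub>R u"
    unfolding nux by (simp add: algebra_simps)
  moreover from this have "a = (2 - norm x) *\<^sub>R u"
    using a by (metis scaleR_left_diff_distrib)
  ultimately show "\<exists>u. norm u = 1 \<and> x = norm x *\<^sub>R u \<and> a = (2 - norm x) *\<^sub>R u"
    using u by blast
next
  assume "\<exists>u. norm u = 1 \<and> x = norm x *\<^sub>R u \<and> a = (2 - norm x) *\<^sub>R u"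
  then obtain u where u: "norm u = 1" "x = norm x *\<^sub>R u" "a = (2 - norm x) *\<^sub>R u"
    by blast
  have "x + a = 2 *\<^sub>R u"
    using u(2,3) by (metis scaleR_left_distrib add.commute diff_add_cancel)
  then have "midpoint x a = u"
    by (simp add: midpoint_def)
  moreover have "x - a = (2 * (norm x - 1)) *\<^sub>R u"
  proof -
    have "x - a = (norm x - (2 - norm x)) *\<^sub>R u"
      using u(2,3) by (metis scaleR_left_diff_distrib)
    then show ?thesis
      by (simp add: algebra_simps)
  qed
  ultimately show "a \<in> bd_reflections unit_disk x"
    using u(1) assms by (simp add: bd_reflections_def bdist_unit_disk dist_norm)
qed

lemma bd_reflections_unit_disk_nonempty:
  assumes "norm x < 1"
  shows "bd_reflections unit_disk x \<noteq> {}"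
  using ex_unit_direction[of x] bd_reflections_unit_disk[OF assms] by blast

section \<open>Comparison of the denominators\<close>

definition w_denom :: "real^2 \<Rightarrow> real^2 \<Rightarrow> real" where
  "w_denom x y = min (infdist x (bd_reflections unit_disk y)) (infdist y (bd_reflections unit_disk x))"

text \<open>Both functions have the numerator \<open>dist x y\<close>, so each bound between them
  amounts to a reversed bound between \<open>w_denom\<close> and \<open>jstar_denom\<close>.\<close>

definition jstar_denom :: "real^2 \<Rightarrow> real^2 \<Rightarrow> real" where
  "jstar_denom x y = dist x y + 2 * min (bdist unit_disk x) (bdist unit_disk y)"

lemma w_denom_commute: "w_denom x y = w_denom y x"
  by (simp add: w_denom_def min.commute)

lemma jstar_denom_commute: "jstar_denom x y = jstar_denom y x"
  by (simp add: jstar_denom_def min.commute dist_commute)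

lemma jstar_denom_pos:
  assumes "norm x < 1" "norm y < 1"
  shows "0 < jstar_denom x y"
  using assms by (simp add: jstar_denom_def bdist_unit_disk add_nonneg_pos)

lemma infdist_reflections_le:
  assumes "norm x < 1"
  shows "infdist y (bd_reflections unit_disk x) \<le> dist x y + 2 * bdist unit_disk x"
proof -
  obtain a where a: "a \<in> bd_reflections unit_disk x"
    using bd_reflections_unit_disk_nonempty[OF assms] by blast
  have "infdist y (bd_reflections unit_disk x) \<le> dist y a"
    using a by (rule infdist_le)
  also have "\<dots> \<le> dist x y + dist x a"
    by (metis dist_triangle dist_commute)
  also have "dist x a = 2 * bdist unit_disk x"
    using a by (simp add: bd_reflections_def)
  finally show ?thesis .
qed

lemma w_denom_le_jstar_denom:
  assumes "norm x < 1" "norm y < 1"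
  shows "w_denom x y \<le> jstar_denom x y"
  using infdist_reflections_le[OF assms(1), of y] infdist_reflections_le[OF assms(2), of x]
  by (auto simp: w_denom_def jstar_denom_def dist_commute min_def)

text \<open>The law of cosines, with \<open>u \<bullet> v\<close> as the cosine of the angle at the
  origin.\<close>

lemma dist_scaleR_unit_square:
  fixes u v :: "'a::real_inner"
  assumes "norm u = 1" "norm v = 1"
  shows "(dist (p *\<^sub>R u) (q *\<^sub>R v))\<^sup>2 = p\<^sup>2 + q\<^sup>2 - 2 * p * q * (u \<bullet> v)"
proof -
  have "u \<bullet> u = 1" "v \<bullet> v = 1"
    using assms by (simp_all add: norm_eq_1)
  then show ?thesis
    unfolding dist_norm power2_norm_eq_inner
    by (simp add: inner_diff_left inner_diff_right inner_commute power2_eq_square)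
qed

text \<open>Each reflection \<open>b\<close> of the inner point \<open>y\<close> is beaten by a
  radial reflection \<open>a\<close> of \<open>x\<close>: by the law of cosines, the squared
  distances differ by a nonnegative multiple of \<open>norm x - norm y\<close>.\<close>

lemma w_denom_outer_reflection:
  assumes "norm x < 1" "norm y \<le> norm x"
  shows "w_denom x y = infdist y (bd_reflections unit_disk x)"
proof -
  have y: "norm y < 1"
    using assms by simp
  have "infdist y (bd_reflections unit_disk x) \<le> infdist x (bd_reflections unit_disk y)"
  proof (rule infdist_greatest[OF bd_reflections_unit_disk_nonempty[OF y]])
    fix b assume "b \<in> bd_reflections unit_disk y"
    then obtain v where v: "norm v = 1" "y = norm y *\<^sub>R v" "b = (2 - norm y) *\<^sub>R v"
      using bd_reflections_unit_disk[OF y] by blast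
    obtain u where u: "norm u = 1" "x = norm x *\<^sub>R u"
      using ex_unit_direction by blast
    define a where "a = (2 - norm x) *\<^sub>R u"
    define c where "c = u \<bullet> v"
    have c: "c \<le> 1"
      using norm_cauchy_schwarz[of u v] u v by (simp add: c_def)
    have "(dist y a)\<^sup>2 = (norm y)\<^sup>2 + (2 - norm x)\<^sup>2 - 2 * norm y * (2 - norm x) * c"
      using dist_scaleR_unit_square[OF v(1) u(1), of "norm y" "2 - norm x"] v(2)[symmetric]
      by (simp add: a_def c_def inner_commute)
    moreover have "(dist x b)\<^sup>2 = (norm x)\<^sup>2 + (2 - norm y)\<^sup>2 - 2 * norm x * (2 - norm y) * c"
      using dist_scaleR_unit_square[OF u(1) v(1), of "norm x" "2 - norm y"] u(2)[symmetric]
      by (simp add: v(3) c_def)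
    ultimately have "(dist x b)\<^sup>2 - (dist y a)\<^sup>2 = 4 * ((norm x - norm y) * (1 - c))"
      by (simp add: algebra_simps power2_eq_square)
    moreover have "0 \<le> (norm x - norm y) * (1 - c)"
      using c assms by simp
    ultimately have "(dist y a)\<^sup>2 \<le> (dist x b)\<^sup>2"
      by linarith
    then have "dist y a \<le> dist x b"
      by (rule power2_le_imp_le) simp
    moreover have "a \<in> bd_reflections unit_disk x"
      using u bd_reflections_unit_disk[OF assms(1)] a_def by blast
    ultimately show "infdist y (bd_reflections unit_disk x) \<le> dist x b"
      using infdist_le2 by blast
  qed
  then show ?thesis
    by (simp add: w_denom_def)
qed

text \<open>Expanding the square of \<open>y - a\<close> leaves the cross term
  \<open>(x - y) \<bullet> (a - x)\<close>. It is nonnegative because \<open>a - x\<close> points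
  radially outwards and \<open>y\<close> reaches no further than \<open>x\<close> in that
  direction.\<close>

lemma dist_reflection_square_ge:
  assumes "norm x < 1" "norm y \<le> norm x" "a \<in> bd_reflections unit_disk x"
  shows "(dist y x)\<^sup>2 + (dist x a)\<^sup>2 \<le> (dist y a)\<^sup>2"
proof -
  obtain u where u: "norm u = 1" "x = norm x *\<^sub>R u" "a = (2 - norm x) *\<^sub>R u"
    using bd_reflections_unit_disk assms by blast
  have "y \<bullet> u \<le> norm y"
    using norm_cauchy_schwarz[of y u] u(1) by simp
  moreover have "x \<bullet> u = norm x"
    using u by (metis inner_scaleR_left mult.right_neutral norm_eq_1)
  ultimately have "(x - y) \<bullet> u \<ge> 0"
    using assms(2) by (simp add: inner_diff_left)
  moreover have "a - x = (2 * (1 - norm x)) *\<^sub>R u"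
  proof -
    have "a - x = ((2 - norm x) - norm x) *\<^sub>R u"
      using u(2,3) by (metis scaleR_left_diff_distrib)
    then show ?thesis
      by (simp add: algebra_simps)
  qed
  ultimately have "(x - y) \<bullet> (a - x) \<ge> 0"
    using assms(1) by simp
  moreover have "(dist y a)\<^sup>2 = (dist y x)\<^sup>2 + (dist x a)\<^sup>2 + 2 * ((x - y) \<bullet> (a - x))"
    unfolding dist_norm power2_norm_eq_inner
    by (simp add: inner_diff_left inner_diff_right inner_commute)
  ultimately show ?thesis
    by simp
qed

lemma jstar_denom_le_ordered:
  assumes "norm x < 1" "norm y \<le> norm x"
  shows "jstar_denom x y \<le> sqrt 2 * w_denom x y"
proof -
  have "jstar_denom x y / sqrt 2 \<le> infdist y (bd_reflections unit_disk x)"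
  proof (rule infdist_greatest[OF bd_reflections_unit_disk_nonempty[OF assms(1)]])
    fix a assume a: "a \<in> bd_reflections unit_disk x"
    have J: "jstar_denom x y = dist y x + dist x a"
      using a assms by (simp add: jstar_denom_def bd_reflections_def bdist_unit_disk dist_commute)
    have "(dist y x + dist x a)\<^sup>2 \<le> 2 * ((dist y x)\<^sup>2 + (dist x a)\<^sup>2)"
      using zero_le_power2[of "dist y x - dist x a"] by (simp add: power2_eq_square algebra_simps)
    also have "\<dots> \<le> (sqrt 2 * dist y a)\<^sup>2"
      using dist_reflection_square_ge[OF assms a] by (simp add: power_mult_distrib)
    finally have "jstar_denom x y \<le> sqrt 2 * dist y a"
      unfolding J by (rule power2_le_imp_le) simp
    then show "jstar_denom x y / sqrt 2 \<le> dist y a"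
      by (simp add: field_simps)
  qed
  then show ?thesis
    using w_denom_outer_reflection[OF assms] by (simp add: field_simps)
qed

lemma jstar_denom_le_sqrt2_w_denom:
  assumes "norm x < 1" "norm y < 1"
  shows "jstar_denom x y \<le> sqrt 2 * w_denom x y"
  using assms jstar_denom_le_ordered[of x y] jstar_denom_le_ordered[of y x]
  by (cases "norm y \<le> norm x") (simp_all add: w_denom_commute[of y x] jstar_denom_commute[of y x])

text \<open>Positivity is inherited from \<open>jstar_denom\<close> through the preceding
  comparison.\<close>

lemma w_denom_pos:
  assumes "norm x < 1" "norm y < 1"
  shows "0 < w_denom x y"
  using jstar_denom_pos[OF assms] jstar_denom_le_sqrt2_w_denom[OF assms]
  by (metis less_le_trans zero_less_mult_pos real_sqrt_gt_0_iff zero_less_numeral)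

section \<open>Equality on rays\<close>

lemma jstar_denom_le_w_denom_ordered:
  assumes "norm x < 1" "norm y \<le> norm x" "dist x y = norm x - norm y"
  shows "jstar_denom x y \<le> w_denom x y"
  unfolding w_denom_outer_reflection[OF assms(1,2)]
proof (rule infdist_greatest[OF bd_reflections_unit_disk_nonempty[OF assms(1)]])
  fix a assume "a \<in> bd_reflections unit_disk x"
  then obtain u where "norm u = 1" "a = (2 - norm x) *\<^sub>R u"
    using bd_reflections_unit_disk[OF assms(1)] by blast
  then have "norm a = 2 - norm x"
    using assms(1) by simp
  \<comment> \<open>The lower bound \<open>norm a - norm y\<close> equals
    \<open>2 - norm x - norm y\<close>, which is \<open>jstar_denom x y\<close> when
    \<open>dist x y = norm x - norm y\<close>.\<close>
  then show "jstar_denom x y \<le> dist y a"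
    using norm_triangle_ineq2[of a y] assms
    by (simp add: jstar_denom_def bdist_unit_disk dist_norm norm_minus_commute)
qed

lemma w_denom_eq_jstar_denom:
  assumes "norm x < 1" "norm y < 1" "dist x y = \<bar>norm x - norm y\<bar>"
  shows "w_denom x y = jstar_denom x y"
proof (rule antisym[OF w_denom_le_jstar_denom[OF assms(1,2)]])
  show "jstar_denom x y \<le> w_denom x y"
    using assms jstar_denom_le_w_denom_ordered[of x y] jstar_denom_le_w_denom_ordered[of y x]
    by (cases "norm y \<le> norm x")
      (simp_all add: w_denom_commute[of y x] jstar_denom_commute[of y x] dist_commute[of y x])
qed

lemma origin_ray_dist:
  assumes "x \<in> origin_ray u" "y \<in> origin_ray u"
  shows "dist x y = \<bar>norm x - norm y\<bar>"
proof -
  obtain p q where "x = p *\<^sub>R u" "p \<ge> 0" "y = q *\<^sub>R u" "q \<ge> 0"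
    using assms by (auto simp: origin_ray_def)
  then show ?thesis
    by (simp add: dist_norm abs_mult flip: scaleR_left_diff_distrib left_diff_distrib)
qed

section \<open>Optimality of the constant\<close>

lemma w_fun_eq: "w_fun unit_disk x y = dist x y / w_denom x y"
  by (simp add: w_fun_def w_denom_def)

lemma jstar_eq: "jstar unit_disk x y = dist x y / jstar_denom x y"
  by (simp add: jstar_def jstar_denom_def)

lemma ratio_lower_bound:
  assumes c: "\<And>x y. x \<in> unit_disk \<Longrightarrow> y \<in> unit_disk \<Longrightarrow>
      w_fun unit_disk x y \<le> c * jstar unit_disk x y"
    and t: "0 < t" "t < 1/2"
  shows "2 / sqrt (2 / (1 - t)) \<le> c"
proof -
  \<comment> \<open>This \<open>h\<close> gives both points the norm \<open>1 - t\<close>, so that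
    their distance \<open>2 * t\<close> is twice their boundary distance.\<close>
  define h where "h = sqrt (1 - 2 * t)"
  have h: "h\<^sup>2 = 1 - 2 * t"
    using t by (simp add: h_def)
  define x :: "real^2" where "x = vector [h, t]"
  define y :: "real^2" where "y = vector [h, - t]"
  have n: "norm x = 1 - t" "norm y = 1 - t"
  proof -
    have "sqrt (h\<^sup>2 + t\<^sup>2) = 1 - t"
    proof (rule real_sqrt_unique)
      show "(1 - t)\<^sup>2 = h\<^sup>2 + t\<^sup>2"
        unfolding h by (simp add: power2_eq_square algebra_simps)
    qed (use t in simp)
    then show "norm x = 1 - t" "norm y = 1 - t"
      by (simp_all add: x_def y_def norm_eq_sqrt_inner inner_vec_def UNIV_2 power2_eq_square)
  qed
  have d: "dist x y = 2 * t"
    using t by (simp add: x_def y_def dist_norm norm_eq_sqrt_inner inner_vec_def UNIV_2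
        real_sqrt_mult)
  have D: "(w_denom x y)\<^sup>2 \<le> (2 * t)\<^sup>2 * (2 / (1 - t))"
  proof -
    define u where "u = x /\<^sub>R (1 - t)"
    define v where "v = y /\<^sub>R (1 - t)"
    have uv: "norm u = 1" "norm v = 1" "x = (1 - t) *\<^sub>R u" "y = (1 - t) *\<^sub>R v"
      using n t by (simp_all add: u_def v_def)
    have a: "(1 + t) *\<^sub>R u \<in> bd_reflections unit_disk x"
      using uv(1,3) n t by (subst bd_reflections_unit_disk) (auto intro!: exI[of _ u])
    \<comment> \<open>The known chord length \<open>2 * t\<close> determines the cosine
      \<open>v \<bullet> u\<close>, which then yields the distance from \<open>y\<close> to the
      reflection \<open>(1 + t) *\<^sub>R u\<close> of \<open>x\<close>.\<close>
    have eq: "(2 * t)\<^sup>2 = 2 * (1 - t)\<^sup>2 * (1 - v \<bullet> u)"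
      using dist_scaleR_unit_square[OF uv(1,2), of "1 - t" "1 - t"] d uv(3,4)
      by (simp add: inner_commute algebra_simps power2_eq_square)
    have "1 - v \<bullet> u = 2 * t\<^sup>2 / (1 - t)\<^sup>2"
      using eq t by (subst nonzero_eq_divide_eq) (simp_all add: power_mult_distrib mult.commute)
    then have c: "v \<bullet> u = 1 - 2 * t\<^sup>2 / (1 - t)\<^sup>2"
      by simp
    have "w_denom x y \<le> dist y ((1 + t) *\<^sub>R u)"
      using infdist_le[OF a, of y] by (simp add: w_denom_def)
    then have "(w_denom x y)\<^sup>2 \<le> (dist y ((1 + t) *\<^sub>R u))\<^sup>2"
      using w_denom_pos[of x y] n t by (intro power_mono) auto
    also have "\<dots> = (1 - t)\<^sup>2 + (1 + t)\<^sup>2 - 2 * (1 - t) * (1 + t) * (v \<bullet> u)"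
      using dist_scaleR_unit_square[OF uv(2,1)] uv(4) by simp
    also have "\<dots> = (2 * t)\<^sup>2 * (2 / (1 - t))"
      unfolding c using t by (simp add: divide_simps) (simp add: algebra_simps power2_eq_square)
    finally show ?thesis .
  qed
  have J: "jstar unit_disk x y = 1 / 2"
    using n t d by (simp add: jstar_def bdist_unit_disk)
  define q where "q = sqrt (2 / (1 - t))"
  have q: "0 < q" "q\<^sup>2 = 2 / (1 - t)"
    using t by (simp_all add: q_def)
  have "(w_denom x y)\<^sup>2 \<le> (2 * t * q)\<^sup>2"
    using D by (simp only: power_mult_distrib q(2))
  then have "w_denom x y \<le> 2 * t * q"
    by (rule power2_le_imp_le) (use q t in simp)
  moreover have "0 < w_denom x y"
    using w_denom_pos n t by simp
  ultimately have "2 * t / (2 * t * q) \<le> 2 * t / w_denom x y"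
    using q t by (intro divide_left_mono) simp_all
  also have "\<dots> \<le> c / 2"
    using c[of x y] n t J d by (simp add: w_fun_eq)
  finally show ?thesis
    using t by (simp add: q_def)
qed

theorem theorem5p13:
  shows "(\<forall>x\<in>unit_disk. \<forall>y\<in>unit_disk.
            jstar unit_disk x y \<le> w_fun unit_disk x y \<and>
            w_fun unit_disk x y \<le> sqrt 2 * jstar unit_disk x y) \<and>
         (\<forall>x\<in>unit_disk. \<forall>y\<in>unit_disk.
            (\<exists>u. u \<noteq> 0 \<and> x \<in> origin_ray u \<and> y \<in> origin_ray u) \<longrightarrow>
            jstar unit_disk x y = w_fun unit_disk x y) \<and>
         (\<forall>c. (\<forall>x\<in>unit_disk. \<forall>y\<in>unit_disk.
                 w_fun unit_disk x y \<le> c * jstar unit_disk x y) \<longrightarrow> sqrt 2 \<le> c)"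
proof (intro conjI ballI allI impI)
  fix x y :: "real^2"
  assume "x \<in> unit_disk" "y \<in> unit_disk"
  then have xy: "norm x < 1" "norm y < 1"
    by simp_all
  note pos = w_denom_pos[OF xy] jstar_denom_pos[OF xy]
  show "jstar unit_disk x y \<le> w_fun unit_disk x y"
    unfolding w_fun_eq jstar_eq using pos w_denom_le_jstar_denom[OF xy]
    by (intro divide_left_mono) auto
  have "dist x y * jstar_denom x y \<le> dist x y * (sqrt 2 * w_denom x y)"
    using jstar_denom_le_sqrt2_w_denom[OF xy] by (rule mult_left_mono) simp
  then show "w_fun unit_disk x y \<le> sqrt 2 * jstar unit_disk x y"
    unfolding w_fun_eq jstar_eq using pos by (simp add: field_simps)
next
  fix x y :: "real^2"
  assume "x \<in> unit_disk" "y \<in> unit_disk"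
    and "\<exists>u. u \<noteq> 0 \<and> x \<in> origin_ray u \<and> y \<in> origin_ray u"
  then show "jstar unit_disk x y = w_fun unit_disk x y"
    using w_denom_eq_jstar_denom origin_ray_dist by (auto simp: w_fun_eq jstar_eq)
next
  fix c
  assume c: "\<forall>x\<in>unit_disk. \<forall>y\<in>unit_disk. w_fun unit_disk x y \<le> c * jstar unit_disk x y"
  \<comment> \<open>The lower bound for \<open>c\<close> holds for all small positive
    \<open>t\<close>, so it persists in the limit from the right, whose value is
    \<open>sqrt 2\<close>.\<close>
  have "((\<lambda>t. 2 / sqrt (2 / (1 - t))) \<longlongrightarrow> 2 / sqrt (2 / (1 - 0))) (at_right (0::real))"
    by (intro tendsto_intros) auto
  moreover have "\<forall>\<^sub>F t in at_right (0::real). 2 / sqrt (2 / (1 - t)) \<le> c"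
    using eventually_at_right_less[of 0] eventually_at_right_real[of 0 "1/2"]
    by (auto elim!: eventually_mono intro!: ratio_lower_bound c[rule_format])
  ultimately have "2 / sqrt (2 / (1 - 0)) \<le> c"
    by (intro tendsto_upperbound) auto
  then show "sqrt 2 \<le> c"
    by (simp add: real_div_sqrt)
qed

end
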